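(* For every $p\ge1$ and $\sigma>0$ there is a constant $C_0>0$, depending only on $p$ and $\sigma$, such that the following holds. Let $f:\mathbb{R}\to\mathbb{R}$ be $C^1$, even and bounded, with $f(0)=0$ and $f'(x)\ge0$ for $x>0$. Then $$-\int_0^1\frac{Hf(x)\,f'(x)\,f(x)^{p-1}}{x^\sigma}\,dx\ \ge\ C_0\int_0^1\frac{f(x)^{p+1}}{x^{1+\sigma}}\,dx.$$ If the right-hand side is infinite, the inequality is understood in the sense that the left-hand side must also be infinite.
   Context: $Hf$ is the Hilbert transform, $Hf(x)=\mathrm{P.V.}\,\frac1\pi\int_{\mathbb{R}}\frac{f(y)}{x-y}\,dy$, with the principal value taken at the singularity $y=x$ and symmetrically at infinity. *)

theory Defs
  imports "HOL-Analysis.Analysis"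
begin

text \<open>
  The truncation at infinity is symmetric about the origin (\<open>\<bar>y\<bar> \<le> N\<close>). For bounded \<open>f\<close>, truncating
  by \<open>\<bar>x - y\<bar> \<le> N\<close> instead gives the same limit: the two regions differ by sets of measure at most
  \<open>2 * \<bar>x\<bar>\<close> on which the integrand is \<open>O(1/N)\<close>. The limits in \<open>\<epsilon>\<close> and \<open>N\<close> are taken jointly.
\<close>

definition hilbert_trunc :: "(real \<Rightarrow> real) \<Rightarrow> real \<Rightarrow> real \<Rightarrow> real \<Rightarrow> real" where
  "hilbert_trunc f x \<epsilon> N =
     1 / pi * (LINT y:{y. \<epsilon> < \<bar>x - y\<bar> \<and> \<bar>y\<bar> \<le> N}|lborel. f y / (x - y))"

definition hilbert :: "(real \<Rightarrow> real) \<Rightarrow> real \<Rightarrow> real" where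
  "hilbert f x = Lim (at_right 0 \<times>\<^sub>F at_top) (\<lambda>(\<epsilon>, N). hilbert_trunc f x \<epsilon> N)"

text \<open>
  Real powers of a nonnegative base with \<open>0\<^sup>0 = 1\<close>; the library has \<open>0 powr 0 = 0\<close>.
\<close>

definition rpow :: "real \<Rightarrow> real \<Rightarrow> real" where
  "rpow a b = (if b = 0 then 1 else a powr b)"

text \<open>
  The Lebesgue integral with values in \<open>[-\<infinity>, \<infinity>]\<close>, and the condition under which it is defined
  (the library's Bochner integral is 0 for non-integrable functions). The value of
  \<open>ext_integral\<close> is meaningless without \<open>quasi_integrable\<close>, since \<open>\<infinity> - \<infinity> = \<infinity>\<close> in \<open>ereal\<close>.
\<close>

definition quasi_integrable :: "real set \<Rightarrow> (real \<Rightarrow> real) \<Rightarrow> bool" where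
  "quasi_integrable S g \<longleftrightarrow>
     set_borel_measurable lborel S g \<and>
     ((\<integral>\<^sup>+x\<in>S. ennreal (g x) \<partial>lborel) < \<infinity> \<or> (\<integral>\<^sup>+x\<in>S. ennreal (- g x) \<partial>lborel) < \<infinity>)"

definition ext_integral :: "real set \<Rightarrow> (real \<Rightarrow> real) \<Rightarrow> ereal" where
  "ext_integral S g =
     enn2ereal (\<integral>\<^sup>+x\<in>S. ennreal (g x) \<partial>lborel) - enn2ereal (\<integral>\<^sup>+x\<in>S. ennreal (- g x) \<partial>lborel)"

end

theory Submission
  imports Defs "HOL-Probability.Sinc_Integral" "HOL-Real_Asymp.Real_Asymp"
begin

text \<open>
  Since \<open>f\<close> is even and the principal value of the integral of \<open>1 / (x - y)\<close> over the line vanishes,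
  \<open>- 2 * pi * hilbert f x\<close> is the integral over \<open>y\<close> of \<open>2 * x * (f y - f x) / (y\<^sup>2 - x\<^sup>2)\<close>, which is
  nonnegative for \<open>x > 0\<close> because \<open>f\<close> increases with \<open>\<bar>y\<bar>\<close>. Keeping only \<open>\<bar>y\<bar> \<le> a\<close> and
  \<open>2 * a \<le> y \<le> 4 * a\<close> gives \<open>- hilbert f x \<ge> c * (f (2 * a) - f a)\<close> on \<open>[a, 2 * a]\<close>. Summing over
  the dyadic intervals with \<open>a\<^sub>k = f (2 powr - k)\<close>, the left-hand side dominates the sum of
  \<open>2 powr (k * \<sigma>) * (a\<^sub>k - a\<^sub>k\<^sub>+\<^sub>1) powr (p + 1)\<close>, the right-hand side is at most a multiple of the sum of
  \<open>2 powr (k * \<sigma>) * a\<^sub>k powr (p + 1)\<close>, and a discrete Hardy inequality compares the two.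
\<close>

lemma powr_add_le_split:
  fixes x y q \<delta> :: real
  assumes "x \<ge> 0" "y \<ge> 0" "q > 0" "\<delta> > 0"
  shows "(x + y) powr q \<le> (1 + \<delta>) powr q * x powr q + (1 + 1 / \<delta>) powr q * y powr q"
proof (cases "y \<le> \<delta> * x")
  case True
  then have "(x + y) powr q \<le> ((1 + \<delta>) * x) powr q"
    using assms by (intro powr_mono2) (auto simp: algebra_simps)
  also have "\<dots> = (1 + \<delta>) powr q * x powr q" using assms by (simp add: powr_mult)
  finally show ?thesis by (smt (verit) mult_nonneg_nonneg powr_ge_zero)
next
  case False
  then have "(x + y) powr q \<le> ((1 + 1 / \<delta>) * y) powr q"
    using assms by (intro powr_mono2) (auto simp: field_simps)
  also have "\<dots> = (1 + 1 / \<delta>) powr q * y powr q" using assms by (simp add: powr_mult)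
  finally show ?thesis by (smt (verit) mult_nonneg_nonneg powr_ge_zero)
qed

lemma weighted_hardy_finite:
  fixes w q :: real
  assumes "w > 1" "q > 0"
  shows "\<exists>C>0. \<forall>(b :: nat \<Rightarrow> real) n. (\<forall>k. b (Suc k) \<le> b k) \<and> b n = 0 \<longrightarrow>
    (\<Sum>k<n. w ^ k * b k powr q) \<le> C * (\<Sum>k<n. w ^ k * (b k - b (Suc k)) powr q)"
proof -
  define \<delta> where "\<delta> = w powr (1 / (2 * q)) - 1"
  define \<theta> where "\<theta> = w powr (- (1 / 2))"
  define B where "B = (1 + 1 / \<delta>) powr q"
  have "w powr 0 < w powr (1 / (2 * q))" using assms by (intro powr_less_mono) auto
  then have \<delta>: "\<delta> > 0" using assms by (simp add: \<delta>_def)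
  have \<delta>q: "(1 + \<delta>) powr q = \<theta> * w"
  proof -
    have "(1 + \<delta>) powr q = w powr (1 / 2)" using assms by (simp add: \<delta>_def powr_powr)
    also have "\<dots> = w powr (- (1 / 2)) * w powr 1" by (subst powr_add[symmetric]) simp
    finally show ?thesis using assms by (simp add: \<theta>_def)
  qed
  have \<theta>: "0 < \<theta>" "\<theta> < 1"
    using assms powr_less_mono[of "- (1 / 2)" 0 w] by (auto simp: \<theta>_def)
  have B: "B > 0" using \<delta> by (simp add: B_def add_pos_pos less_imp_neq[symmetric])
  have "(\<Sum>k<n. w ^ k * b k powr q) \<le> B / (1 - \<theta>) * (\<Sum>k<n. w ^ k * (b k - b (Suc k)) powr q)"
    if dec: "\<forall>k. b (Suc k) \<le> b k" and bn: "b n = 0" for b :: "nat \<Rightarrow> real" and n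
  proof -
    let ?S = "\<Sum>k<n. w ^ k * b k powr q"
    let ?D = "\<Sum>k<n. w ^ k * (b k - b (Suc k)) powr q"
    have nonneg: "b k \<ge> 0" if "k \<le> n" for k
      using lift_Suc_antimono_le[of b k n] dec bn that by auto
    have "?S \<le> (\<Sum>k<n. \<theta> * (w ^ Suc k * b (Suc k) powr q) + B * (w ^ k * (b k - b (Suc k)) powr q))"
    proof (rule sum_mono)
      fix k assume k: "k \<in> {..<n}"
      have "(b (Suc k) + (b k - b (Suc k))) powr q
          \<le> \<theta> * w * b (Suc k) powr q + B * (b k - b (Suc k)) powr q"
        using powr_add_le_split[of "b (Suc k)" "b k - b (Suc k)" q \<delta>] nonneg[of "Suc k"] dec k assms \<delta> \<delta>q
        by (simp add: B_def)
      then have "w ^ k * b k powr q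
          \<le> w ^ k * (\<theta> * w * b (Suc k) powr q + B * (b k - b (Suc k)) powr q)"
        using assms by (intro mult_left_mono) auto
      then show "w ^ k * b k powr q
          \<le> \<theta> * (w ^ Suc k * b (Suc k) powr q) + B * (w ^ k * (b k - b (Suc k)) powr q)"
        by (simp add: algebra_simps)
    qed
    also have "\<dots> = \<theta> * (\<Sum>k<n. w ^ Suc k * b (Suc k) powr q) + B * ?D"
      by (simp add: sum.distrib sum_distrib_left)
    finally have le: "?S \<le> \<theta> * (\<Sum>k<n. w ^ Suc k * b (Suc k) powr q) + B * ?D" .
    have "(\<Sum>k<n. w ^ Suc k * b (Suc k) powr q) = (\<Sum>k<Suc n. w ^ k * b k powr q) - b 0 powr q"
      by (subst sum.lessThan_Suc_shift) simp
    also have "\<dots> \<le> ?S" using bn by simp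
    finally have "\<theta> * (\<Sum>k<n. w ^ Suc k * b (Suc k) powr q) \<le> \<theta> * ?S"
      using \<theta> by (intro mult_left_mono) auto
    with le have "?S \<le> \<theta> * ?S + B * ?D" by linarith
    then have "(1 - \<theta>) * ?S \<le> B * ?D" by (simp add: algebra_simps)
    then show ?thesis using \<theta> by (simp add: field_simps)
  qed
  moreover have "B / (1 - \<theta>) > 0" using B \<theta> by simp
  ultimately show ?thesis by blast
qed

lemma weighted_hardy:
  fixes w q :: real
  assumes "w > 1" "q > 0"
  shows "\<exists>C>0. \<forall>a :: nat \<Rightarrow> real. decseq a \<and> a \<longlonglongrightarrow> 0 \<longrightarrow>
    (\<Sum>k. ennreal (w ^ k * a k powr q)) \<le> ennreal C * (\<Sum>k. ennreal (w ^ k * (a k - a (Suc k)) powr q))"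
proof -
  obtain C where C: "C > 0" and hardy: "\<And>b n. \<forall>k. b (Suc k) \<le> b k \<Longrightarrow> b n = 0 \<Longrightarrow>
      (\<Sum>k<n. w ^ k * b k powr q) \<le> C * (\<Sum>k<n. w ^ k * (b k - b (Suc k)) powr q)"
    using weighted_hardy_finite[OF assms] by blast
  have "(\<Sum>k. ennreal (w ^ k * a k powr q)) \<le> ennreal C * (\<Sum>k. ennreal (w ^ k * (a k - a (Suc k)) powr q))"
    if dec: "decseq a" and lim: "a \<longlonglongrightarrow> 0" for a :: "nat \<Rightarrow> real"
  proof (rule suminf_le_const)
    fix m
    let ?D = "\<Sum>k. ennreal (w ^ k * (a k - a (Suc k)) powr q)"
    \<comment> \<open>The finite inequality needs a last term 0; subtracting \<open>a n\<close> achieves this without changing the differences.\<close>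
    have bound: "ennreal (\<Sum>k<m. w ^ k * (a k - a n) powr q) \<le> ennreal C * ?D" if "m \<le> n" for n
    proof -
      have "(\<Sum>k<m. w ^ k * (a k - a n) powr q) \<le> (\<Sum>k<n. w ^ k * (a k - a n) powr q)"
        using that assms by (intro sum_mono2) auto
      also have "\<dots> \<le> C * (\<Sum>k<n. w ^ k * ((a k - a n) - (a (Suc k) - a n)) powr q)"
        using dec by (intro hardy) (auto simp: decseq_Suc_iff)
      finally have "ennreal (\<Sum>k<m. w ^ k * (a k - a n) powr q)
          \<le> ennreal C * ennreal (\<Sum>k<n. w ^ k * (a k - a (Suc k)) powr q)"
        using C assms by (simp flip: ennreal_mult add: sum_nonneg ennreal_leI)
      also have "ennreal (\<Sum>k<n. w ^ k * (a k - a (Suc k)) powr q)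
          = (\<Sum>k<n. ennreal (w ^ k * (a k - a (Suc k)) powr q))"
        using assms by (intro sum_ennreal[symmetric]) auto
      also have "ennreal C * \<dots> \<le> ennreal C * ?D"
        by (intro mult_left_mono sum_le_suminf) auto
      finally show ?thesis .
    qed
    have "(\<lambda>n. a k - a n) \<longlonglongrightarrow> a k" for k using tendsto_diff[OF tendsto_const lim, of "a k"] by simp
    then have "(\<lambda>n. \<Sum>k<m. w ^ k * (a k - a n) powr q) \<longlonglongrightarrow> (\<Sum>k<m. w ^ k * a k powr q)"
      using dec assms by (intro tendsto_sum tendsto_mult tendsto_const tendsto_powr2)
        (auto simp: eventually_sequentially decseq_def)
    then have "ennreal (\<Sum>k<m. w ^ k * a k powr q) \<le> ennreal C * ?D"
      by (intro Lim_bounded[OF tendsto_ennrealI]) (auto intro: bound)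
    then show "(\<Sum>k<m. ennreal (w ^ k * a k powr q)) \<le> ennreal C * ?D"
      using assms by (subst sum_ennreal) auto
  qed auto
  with C show ?thesis by blast
qed

definition quot :: "(real \<Rightarrow> real) \<Rightarrow> real \<Rightarrow> real \<Rightarrow> real" where
  "quot f x y = (f y - f x) / (x - y)"

definition hilbert_kernel :: "(real \<Rightarrow> real) \<Rightarrow> real \<Rightarrow> real \<Rightarrow> real" where
  "hilbert_kernel f x y = 2 * x * (f y - f x) / (y\<^sup>2 - x\<^sup>2)"

lemma inverse_1_plus_square_integrable: "integrable lborel (\<lambda>x::real. inverse (1 + x\<^sup>2))"
  using integrable_inverse_1_plus_square by (simp add: set_integrable_def)

locale even_profile =
  fixes f :: "real \<Rightarrow> real"
  assumes C1: "f C1_differentiable_on UNIV"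
    and even: "f (- x) = f x"
    and bounded: "bounded (range f)"
    and zero: "f 0 = 0"
    and deriv_nonneg: "x > 0 \<Longrightarrow> deriv f x \<ge> 0"
begin

lemma has_deriv: "(f has_real_derivative deriv f x) (at x)"
  using C1 by (simp add: C1_differentiable_on_eq DERIV_deriv_iff_real_differentiable)

lemma continuous_deriv: "continuous_on UNIV (deriv f)"
proof -
  have "vector_derivative f (at x) = deriv f x" for x
    using has_deriv[of x] by (simp add: has_real_derivative_iff_has_vector_derivative vector_derivative_at)
  then show ?thesis using C1 by (simp add: C1_differentiable_on_eq)
qed

lemma continuous_f: "continuous_on UNIV f"
  by (meson DERIV_isCont continuous_at_imp_continuous_on has_deriv)

lemma measurable_f [measurable]: "f \<in> borel_measurable borel"
  by (rule borel_measurable_continuous_onI[OF continuous_f])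

lemma measurable_deriv [measurable]: "deriv f \<in> borel_measurable borel"
  by (rule borel_measurable_continuous_onI[OF continuous_deriv])

lemma measurable_quot [measurable]: "quot f x \<in> borel_measurable borel"
  unfolding quot_def[abs_def] by measurable

lemma measurable_hilbert_kernel [measurable]: "hilbert_kernel f x \<in> borel_measurable borel"
  unfolding hilbert_kernel_def[abs_def] by measurable

lemma mono: "0 \<le> x \<Longrightarrow> x \<le> y \<Longrightarrow> f x \<le> f y"
  using has_deriv continuous_f
  by (intro DERIV_nonneg_imp_increasing_open[of x y f])
    (force intro: deriv_nonneg continuous_on_subset)+

lemma mono_abs: "\<bar>x\<bar> \<le> \<bar>y\<bar> \<Longrightarrow> f x \<le> f y"
  using mono[of "\<bar>x\<bar>" "\<bar>y\<bar>"] even[of x] even[of y] by (simp add: abs_if split: if_splits)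

lemma nonneg: "f x \<ge> 0"
  using mono_abs[of 0 x] zero by simp

lemma obtain_bound: obtains B where "B > 0" "\<And>x. f x \<le> B"
proof -
  obtain B where "\<forall>x. \<bar>f x\<bar> \<le> B" using bounded by (auto simp: bounded_iff)
  then have "f x \<le> max B 1" for x by (metis abs_ge_self order_trans max.cobounded1)
  then show thesis by (intro that[of "max B 1"]) auto
qed

lemma obtain_lipschitz:
  obtains M where "M \<ge> 0" "\<And>y z. \<bar>y\<bar> \<le> R \<Longrightarrow> \<bar>z\<bar> \<le> R \<Longrightarrow> \<bar>f y - f z\<bar> \<le> M * \<bar>y - z\<bar>"
proof -
  have "compact (deriv f ` {-R..R})"
    by (intro compact_continuous_image continuous_on_subset[OF continuous_deriv]) auto
  then obtain M where M: "\<forall>y\<in>{-R..R}. \<bar>deriv f y\<bar> \<le> M"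
    by (auto dest!: compact_imp_bounded simp: bounded_iff)
  have "\<bar>f y - f z\<bar> \<le> max M 0 * \<bar>y - z\<bar>" if "\<bar>y\<bar> \<le> R" "\<bar>z\<bar> \<le> R" for y z
  proof -
    have "norm (f y - f z) \<le> max M 0 * norm (y - z)"
      by (rule field_differentiable_bound[of "{-R..R}" f "deriv f"])
        (use that M in \<open>auto intro: has_field_derivative_at_within has_deriv simp: abs_le_iff le_max_iff_disj\<close>)
    then show ?thesis by simp
  qed
  then show thesis by (intro that[of "max M 0"]) auto
qed

lemma quot_reflect: "x \<noteq> 0 \<Longrightarrow> quot f x y + quot f x (- y) = - hilbert_kernel f x y"
proof -
  assume "x \<noteq> 0"
  show ?thesis
  proof (cases "y = x \<or> y = - x")
    case True
    then show ?thesis by (auto simp: quot_def hilbert_kernel_def even)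
  next
    case False
    then have "x - y \<noteq> 0" "x + y \<noteq> 0" by auto
    then have "quot f x y + quot f x (- y)
        = ((f y - f x) * (x + y) + (f y - f x) * (x - y)) / ((x - y) * (x + y))"
      using add_frac_eq[of "x - y" "x + y" "f y - f x" "f y - f x"] by (simp add: quot_def even)
    also have "(f y - f x) * (x + y) + (f y - f x) * (x - y) = 2 * x * (f y - f x)" by algebra
    also have "(x - y) * (x + y) = - (y\<^sup>2 - x\<^sup>2)" by algebra
    finally show ?thesis unfolding hilbert_kernel_def by (simp only: divide_minus_right)
  qed
qed

lemma hilbert_kernel_nonneg: "x > 0 \<Longrightarrow> hilbert_kernel f x y \<ge> 0"
proof (cases "\<bar>y\<bar> \<le> x")
  case True
  assume "x > 0"
  have "y\<^sup>2 \<le> x\<^sup>2" using True by (simp add: abs_le_square_iff[symmetric])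
  moreover have "f y \<le> f x" using True \<open>x > 0\<close> by (intro mono_abs) auto
  ultimately show ?thesis using \<open>x > 0\<close>
    unfolding hilbert_kernel_def by (intro divide_nonpos_nonpos mult_nonneg_nonpos) auto
next
  case False
  assume "x > 0"
  have "x\<^sup>2 \<le> y\<^sup>2" using False \<open>x > 0\<close> by (simp add: abs_le_square_iff[symmetric])
  moreover have "f x \<le> f y" using False \<open>x > 0\<close> by (intro mono_abs) auto
  ultimately show ?thesis using \<open>x > 0\<close>
    unfolding hilbert_kernel_def by (intro divide_nonneg_nonneg mult_nonneg_nonneg) auto
qed

lemma quot_bound:
  assumes "\<And>y z. \<bar>y\<bar> \<le> R \<Longrightarrow> \<bar>z\<bar> \<le> R \<Longrightarrow> \<bar>f y - f z\<bar> \<le> M * \<bar>y - z\<bar>" "M \<ge> 0"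
    and "\<bar>x\<bar> \<le> R" "\<bar>y\<bar> \<le> R"
  shows "\<bar>quot f x y\<bar> \<le> M"
proof (cases "y = x")
  case False
  then show ?thesis using assms(1)[of y x] assms(3,4)
    by (simp add: quot_def abs_divide abs_minus_commute divide_le_eq)
qed (use assms in \<open>simp add: quot_def\<close>)

lemma quot_integrable:
  assumes "S \<in> sets borel" "S \<subseteq> {-R..R}"
  shows "set_integrable lborel S (quot f x)"
proof -
  obtain M where M: "M \<ge> 0"
    "\<And>y z. \<bar>y\<bar> \<le> max R \<bar>x\<bar> \<Longrightarrow> \<bar>z\<bar> \<le> max R \<bar>x\<bar> \<Longrightarrow> \<bar>f y - f z\<bar> \<le> M * \<bar>y - z\<bar>"
    by (rule obtain_lipschitz[of "max R \<bar>x\<bar>"]) blast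
  have "set_integrable lborel {-R..R} (quot f x)"
    unfolding set_integrable_def
    by (rule integrableI_bounded_set_indicator[where B=M])
      (auto intro!: AE_I2 quot_bound[OF M(2) M(1)] simp: emeasure_lborel_Icc_eq)
  then show ?thesis using assms by (auto intro: set_integrable_subset)
qed

lemma hilbert_kernel_integrable:
  assumes x: "x > 0"
  shows "integrable lborel (hilbert_kernel f x)"
proof -
  obtain B where B: "B > 0" "\<And>x. f x \<le> B" by (rule obtain_bound) blast
  obtain M where M: "M \<ge> 0"
    "\<And>y z. \<bar>y\<bar> \<le> 2 * x \<Longrightarrow> \<bar>z\<bar> \<le> 2 * x \<Longrightarrow> \<bar>f y - f z\<bar> \<le> M * \<bar>y - z\<bar>"
    by (rule obtain_lipschitz[of "2 * x"]) blast
  define C1 where "C1 = 2 * M * (1 + 4 * x\<^sup>2)"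
  define C2 where "C2 = (8 / 3) * x * B * (1 + 1 / (4 * x\<^sup>2))"
  have C: "C1 \<ge> 0" "C2 \<ge> 0" using M B x by (auto simp: C1_def C2_def)
  have bnd: "\<bar>hilbert_kernel f x y\<bar> \<le> (C1 + C2) * inverse (1 + y\<^sup>2)" for y
  proof (cases "\<bar>y\<bar> \<le> 2 * x")
    case True
    have "\<bar>hilbert_kernel f x y\<bar> = \<bar>quot f x y + quot f x (- y)\<bar>" using quot_reflect[of x y] x by simp
    also have "\<dots> \<le> M + M"
      using quot_bound[OF M(2) M(1), where x=x and y=y] quot_bound[OF M(2) M(1), where x=x and y="-y"] True x
      by (intro order_trans[OF abs_triangle_ineq] add_mono) auto
    also have "\<dots> = C1 * inverse (1 + 4 * x\<^sup>2)"
    proof -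
      have "1 + 4 * x\<^sup>2 \<noteq> 0" by (smt (verit) zero_le_power2)
      then show ?thesis by (simp add: C1_def)
    qed
    also have "\<dots> \<le> C1 * inverse (1 + y\<^sup>2)"
    proof -
      have "y\<^sup>2 \<le> (2 * x)\<^sup>2" using True x abs_le_square_iff[of y "2 * x"] by simp
      then show ?thesis using C by (intro mult_left_mono le_imp_inverse_le add_pos_nonneg) auto
    qed
    also have "\<dots> \<le> (C1 + C2) * inverse (1 + y\<^sup>2)" using C by (intro mult_right_mono) auto
    finally show ?thesis .
  next
    case False
    have y: "4 * x\<^sup>2 \<le> y\<^sup>2" using False x abs_le_square_iff[of "2 * x" y] by simp
    have x2: "x\<^sup>2 > 0" using x by simp
    with y have "x\<^sup>2 < y\<^sup>2" by linarith
    have "\<bar>hilbert_kernel f x y\<bar> = hilbert_kernel f x y" using hilbert_kernel_nonneg[OF x, of y] by simp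
    also have "\<dots> \<le> 2 * x * B / (y\<^sup>2 - x\<^sup>2)"
      unfolding hilbert_kernel_def using y x2 x B(2)[of y] nonneg[of x]
      by (intro divide_right_mono mult_left_mono) linarith+
    also have "\<dots> \<le> 2 * x * B / (3 / 4 * y\<^sup>2)"
      by (intro divide_left_mono mult_pos_pos) (use y \<open>x\<^sup>2 < y\<^sup>2\<close> x B in \<open>auto simp: less_imp_neq[symmetric]\<close>)
    also have "\<dots> = (8 / 3 * x * B) * (1 / y\<^sup>2)" by simp
    also have "\<dots> \<le> (8 / 3 * x * B) * ((1 + 1 / (4 * x\<^sup>2)) * inverse (1 + y\<^sup>2))"
    proof (rule mult_left_mono)
      have "y\<^sup>2 > 0" using y x2 by linarith
      moreover have "1 + y\<^sup>2 \<noteq> 0" using zero_le_power2[of y] by linarith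
      ultimately have "1 / y\<^sup>2 = (1 + 1 / y\<^sup>2) * inverse (1 + y\<^sup>2)" by (simp add: divide_simps)
      also have "\<dots> \<le> (1 + 1 / (4 * x\<^sup>2)) * inverse (1 + y\<^sup>2)"
        using y x2 \<open>y\<^sup>2 > 0\<close> by (intro mult_right_mono add_left_mono divide_left_mono) auto
      finally show "1 / y\<^sup>2 \<le> (1 + 1 / (4 * x\<^sup>2)) * inverse (1 + y\<^sup>2)" .
    qed (use x B in auto)
    also have "\<dots> = C2 * inverse (1 + y\<^sup>2)" by (simp add: C2_def)
    also have "\<dots> \<le> (C1 + C2) * inverse (1 + y\<^sup>2)" using C by (intro mult_right_mono) auto
    finally show ?thesis .
  qed
  show ?thesis
  proof (rule Bochner_Integration.integrable_bound)
    show "integrable lborel (\<lambda>y. (C1 + C2) * inverse (1 + y\<^sup>2))"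
      using inverse_1_plus_square_integrable by (intro integrable_mult_right) auto
    show "AE y in lborel. norm (hilbert_kernel f x y) \<le> norm ((C1 + C2) * inverse (1 + y\<^sup>2))"
      using order_trans[OF bnd abs_ge_self] by (intro AE_I2) (simp only: real_norm_def)
  qed measurable
qed

end

lemma has_bochner_integral_inverse_trunc:
  fixes x \<epsilon> N :: real
  assumes "\<epsilon> > 0" "\<bar>x\<bar> + \<epsilon> < N"
  shows "has_bochner_integral lborel
    (\<lambda>y. indicator {y. \<epsilon> < \<bar>x - y\<bar> \<and> \<bar>y\<bar> \<le> N} y * (1 / (x - y))) (ln ((x + N) / (N - x)))"
proof -
  have left: "has_bochner_integral lborel (\<lambda>y. 1 / (x - y) * indicator {- N..x - \<epsilon>} y)
      (- ln (x - (x - \<epsilon>)) - - ln (x - (- N)))"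
    using assms by (intro has_bochner_integral_FTC_Icc_real)
      (auto intro!: derivative_eq_intros continuous_intros simp: field_simps)
  have right: "has_bochner_integral lborel (\<lambda>y. 1 / (x - y) * indicator {x + \<epsilon>..N} y)
      (- ln (N - x) - - ln (x + \<epsilon> - x))"
    using assms by (intro has_bochner_integral_FTC_Icc_real)
      (auto intro!: derivative_eq_intros continuous_intros simp: field_simps)
  have "has_bochner_integral lborel
      (\<lambda>y. 1 / (x - y) * indicator {- N..x - \<epsilon>} y + 1 / (x - y) * indicator {x + \<epsilon>..N} y)
      (ln ((x + N) / (N - x)))"
  proof -
    have "0 < x + N" "0 < N - x" using assms by auto
    then have "- ln (x - (x - \<epsilon>)) - - ln (x - (- N)) + (- ln (N - x) - - ln (x + \<epsilon> - x)) = ln ((x + N) / (N - x))"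
      by (subst ln_div) auto
    then show ?thesis using has_bochner_integral_add[OF left right] by simp
  qed
  moreover have "AE y in lborel. 1 / (x - y) * indicator {- N..x - \<epsilon>} y + 1 / (x - y) * indicator {x + \<epsilon>..N} y
      = indicator {y. \<epsilon> < \<bar>x - y\<bar> \<and> \<bar>y\<bar> \<le> N} y * (1 / (x - y))"
    using AE_lborel_singleton[of "x - \<epsilon>"] AE_lborel_singleton[of "x + \<epsilon>"]
    by eventually_elim (use assms in \<open>auto simp: indicator_def abs_if split: if_splits\<close>)
  ultimately show ?thesis
    by (subst has_bochner_integral_cong_AE[symmetric]) auto
qed

context even_profile
begin

lemma integral_quot_symmetric:
  assumes "x > 0"
  shows "(LINT y:{-N..N}|lborel. quot f x y) = - (1 / 2) * (LINT y:{-N..N}|lborel. hilbert_kernel f x y)"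
proof -
  have int: "set_integrable lborel {-N..N} (quot f x)" by (rule quot_integrable[of _ N]) auto
  have eq: "{y. - y \<in> {-N..N}} = {-N..N}" by auto
  have int': "set_integrable lborel {-N..N} (\<lambda>y. quot f x (- y))"
    using int unfolding set_integrable_def
    by (subst lborel_integrable_real_affine_iff[of "-1" _ 0, symmetric])
       (auto simp: indicator_def minus_le_iff le_minus_iff conj_commute)
  have "2 * (LINT y:{-N..N}|lborel. quot f x y)
      = (LINT y:{-N..N}|lborel. quot f x y) + (LINT y:{-N..N}|lborel. quot f x (- y))"
    using set_integral_reflect[of "{-N..N}" "quot f x"] eq by simp
  also have "\<dots> = (LINT y:{-N..N}|lborel. quot f x y + quot f x (- y))"
    using int int' by (rule set_integral_add(2)[symmetric])
  also have "\<dots> = - (LINT y:{-N..N}|lborel. hilbert_kernel f x y)"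
    using assms by (simp add: quot_reflect set_lebesgue_integral_def)
  finally show ?thesis by simp
qed

lemma hilbert_trunc_eq:
  assumes x: "x > 0" and \<epsilon>: "\<epsilon> > 0" "x + \<epsilon> < N"
  shows "pi * hilbert_trunc f x \<epsilon> N = - (1 / 2) * (LINT y:{-N..N}|lborel. hilbert_kernel f x y)
    - (LINT y:{x - \<epsilon>..x + \<epsilon>}|lborel. quot f x y) + f x * ln ((x + N) / (N - x))"
proof -
  let ?A = "{y. \<epsilon> < \<bar>x - y\<bar> \<and> \<bar>y\<bar> \<le> N}"
  have A: "?A = {-N..N} - {x - \<epsilon>..x + \<epsilon>}" by (auto simp: abs_if split: if_splits)
  have sub: "{x - \<epsilon>..x + \<epsilon>} \<subseteq> {-N..N}" using x \<epsilon> by auto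
  have int: "set_integrable lborel ?A (quot f x)"
    unfolding A by (rule quot_integrable[of _ N]) auto
  have inv: "has_bochner_integral lborel (\<lambda>y. indicator ?A y * (1 / (x - y))) (ln ((x + N) / (N - x)))"
    using has_bochner_integral_inverse_trunc[of \<epsilon> x N] x \<epsilon> by simp
  have "pi * hilbert_trunc f x \<epsilon> N = (LINT y:?A|lborel. quot f x y + f x * (1 / (x - y)))"
    by (simp add: hilbert_trunc_def quot_def diff_divide_distrib)
  also have "\<dots> = (LINT y:?A|lborel. quot f x y) + (LINT y:?A|lborel. f x * (1 / (x - y)))"
    using inv by (intro set_integral_add(2) int set_integrable_mult_right)
      (auto simp: set_integrable_def has_bochner_integral_iff)
  also have "(LINT y:?A|lborel. f x * (1 / (x - y))) = f x * ln ((x + N) / (N - x))"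
    using inv by (subst set_integral_mult_right) (simp add: set_lebesgue_integral_def has_bochner_integral_iff)
  also have "(LINT y:?A|lborel. quot f x y)
      = (LINT y:{-N..N}|lborel. quot f x y) - (LINT y:{x - \<epsilon>..x + \<epsilon>}|lborel. quot f x y)"
  proof -
    have "(LINT y:?A \<union> {x - \<epsilon>..x + \<epsilon>}|lborel. quot f x y)
        = (LINT y:?A|lborel. quot f x y) + (LINT y:{x - \<epsilon>..x + \<epsilon>}|lborel. quot f x y)"
      using sub by (intro set_integral_Un int quot_integrable[of _ N]) (auto simp: A)
    moreover have "?A \<union> {x - \<epsilon>..x + \<epsilon>} = {-N..N}" using sub by (auto simp: A)
    ultimately show ?thesis by simp
  qed
  finally show ?thesis using integral_quot_symmetric[OF x, of N] by simp
qed

lemma hilbert_trunc_tendsto: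
  assumes x: "x > 0"
  shows "((\<lambda>(\<epsilon>, N). hilbert_trunc f x \<epsilon> N) \<longlongrightarrow> - (1 / (2 * pi)) * (LINT y|lborel. hilbert_kernel f x y))
    (at_right 0 \<times>\<^sub>F at_top)"
proof -
  obtain M where M: "M \<ge> 0"
    "\<And>y z. \<bar>y\<bar> \<le> 2 * x \<Longrightarrow> \<bar>z\<bar> \<le> 2 * x \<Longrightarrow> \<bar>f y - f z\<bar> \<le> M * \<bar>y - z\<bar>"
    by (rule obtain_lipschitz[of "2 * x"]) blast
  have K: "((\<lambda>N. LINT y:{-N..N}|lborel. hilbert_kernel f x y) \<longlongrightarrow> (LINT y|lborel. hilbert_kernel f x y)) at_top"
    unfolding set_lebesgue_integral_def
  proof (rule integral_dominated_convergence_at_top[where w="\<lambda>y. \<bar>hilbert_kernel f x y\<bar>"])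
    show "AE y in lborel. ((\<lambda>N. indicator {-N..N} y *\<^sub>R hilbert_kernel f x y) \<longlongrightarrow> hilbert_kernel f x y) at_top"
    proof (intro AE_I2 tendsto_eventually)
      fix y
      show "\<forall>\<^sub>F N in at_top. indicator {-N..N} y *\<^sub>R hilbert_kernel f x y = hilbert_kernel f x y"
        using eventually_ge_at_top[of "\<bar>y\<bar>"] by eventually_elim (auto simp: indicator_def)
    qed
  qed (use hilbert_kernel_integrable[OF x] in \<open>auto intro!: always_eventually AE_I2 simp: indicator_def\<close>)
  have \<epsilon>: "\<forall>\<^sub>F \<epsilon> in at_right 0. 0 < \<epsilon> \<and> \<epsilon> < x"
    using x by (auto simp: eventually_at_right)
  have Q: "((\<lambda>\<epsilon>. LINT y:{x - \<epsilon>..x + \<epsilon>}|lborel. quot f x y) \<longlongrightarrow> 0) (at_right 0)"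
  proof (rule Lim_null_comparison)
    show "\<forall>\<^sub>F \<epsilon> in at_right 0. norm (LINT y:{x - \<epsilon>..x + \<epsilon>}|lborel. quot f x y) \<le> M * (2 * \<epsilon>)"
      using \<epsilon>
    proof eventually_elim
      case (elim \<epsilon>)
      have "norm (LINT y:{x - \<epsilon>..x + \<epsilon>}|lborel. quot f x y) \<le> (LINT y:{x - \<epsilon>..x + \<epsilon>}|lborel. norm (quot f x y))"
        by (intro set_integral_norm_bound quot_integrable[of _ "x + \<epsilon>"]) (use x elim in auto)
      also have "\<dots> \<le> (LINT y:{x - \<epsilon>..x + \<epsilon>}|lborel. M)"
      proof (rule set_integral_mono)
        show "set_integrable lborel {x - \<epsilon>..x + \<epsilon>} (\<lambda>y. norm (quot f x y))"
          by (intro set_integrable_norm quot_integrable[of _ "x + \<epsilon>"]) (use x elim in auto)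
        show "set_integrable lborel {x - \<epsilon>..x + \<epsilon>} (\<lambda>y. M)"
          by (simp add: set_integrable_def emeasure_lborel_Icc_eq)
        show "norm (quot f x y) \<le> M" if "y \<in> {x - \<epsilon>..x + \<epsilon>}" for y
          using quot_bound[OF M(2) M(1), where x=x and y=y] that x elim by simp
      qed
      also have "\<dots> = M * (2 * \<epsilon>)"
        using elim by (simp add: set_lebesgue_integral_def)
      finally show ?case .
    qed
    show "((\<lambda>\<epsilon>. M * (2 * \<epsilon>)) \<longlongrightarrow> 0) (at_right 0)"
      by (auto intro!: tendsto_eq_intros)
  qed
  have L: "((\<lambda>N. ln ((x + N) / (N - x))) \<longlongrightarrow> 0) at_top" by real_asymp
  have "((\<lambda>(\<epsilon>, N). (- (1 / 2) * (LINT y:{-N..N}|lborel. hilbert_kernel f x y)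
      - (LINT y:{x - \<epsilon>..x + \<epsilon>}|lborel. quot f x y) + f x * ln ((x + N) / (N - x))) / pi)
      \<longlongrightarrow> (- (1 / 2) * (LINT y|lborel. hilbert_kernel f x y) - 0 + f x * 0) / pi) (at_right 0 \<times>\<^sub>F at_top)"
    unfolding case_prod_beta
    by (intro tendsto_intros filterlim_compose[OF K filterlim_snd]
        filterlim_compose[OF Q filterlim_fst] filterlim_compose[OF L filterlim_snd]) auto
  moreover have "\<forall>\<^sub>F z in at_right 0 \<times>\<^sub>F at_top.
      (case z of (\<epsilon>, N) \<Rightarrow> (- (1 / 2) * (LINT y:{-N..N}|lborel. hilbert_kernel f x y)
      - (LINT y:{x - \<epsilon>..x + \<epsilon>}|lborel. quot f x y) + f x * ln ((x + N) / (N - x))) / pi)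
      = (case z of (\<epsilon>, N) \<Rightarrow> hilbert_trunc f x \<epsilon> N)"
    unfolding eventually_prod_filter
  proof (intro exI conjI allI impI)
    show "\<forall>\<^sub>F \<epsilon> in at_right 0. 0 < \<epsilon> \<and> \<epsilon> < x" by (rule \<epsilon>)
    show "\<forall>\<^sub>F N in at_top. 2 * x < N" by (rule eventually_gt_at_top)
    fix \<epsilon> N assume "0 < \<epsilon> \<and> \<epsilon> < x" "2 * x < N"
    with hilbert_trunc_eq[OF x, of \<epsilon> N]
    show "(case (\<epsilon>, N) of (\<epsilon>, N) \<Rightarrow> (- (1 / 2) * (LINT y:{-N..N}|lborel. hilbert_kernel f x y)
      - (LINT y:{x - \<epsilon>..x + \<epsilon>}|lborel. quot f x y) + f x * ln ((x + N) / (N - x))) / pi)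
      = (case (\<epsilon>, N) of (\<epsilon>, N) \<Rightarrow> hilbert_trunc f x \<epsilon> N)"
      by (simp add: field_simps)
  qed
  ultimately show ?thesis by (simp add: tendsto_cong)
qed

lemma hilbert_eq:
  "x > 0 \<Longrightarrow> hilbert f x = - (1 / (2 * pi)) * (LINT y|lborel. hilbert_kernel f x y)"
  unfolding hilbert_def
  by (rule tendsto_Lim[OF _ hilbert_trunc_tendsto]) (auto simp: prod_filter_eq_bot)

lemma hilbert_nonpos: "x > 0 \<Longrightarrow> hilbert f x \<le> 0"
  using hilbert_eq[of x] Bochner_Integration.integral_nonneg[of lborel "hilbert_kernel f x"] hilbert_kernel_nonneg by (simp add: zero_le_mult_iff)

lemma hilbert_kernel_ge_inner:
  assumes "0 < a" "a \<le> x" "x \<le> 2 * a" "\<bar>y\<bar> \<le> a"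
  shows "(f x - f a) / a \<le> hilbert_kernel f x y"
proof (cases "\<bar>y\<bar> = x")
  case True
  then have "x = a" using assms by simp
  then show ?thesis using hilbert_kernel_nonneg[of x y] assms by simp
next
  case False
  have fa: "f y \<le> f a" "f a \<le> f x" using assms by (auto intro!: mono_abs)
  have lt: "y\<^sup>2 < x\<^sup>2" using False assms abs_le_square_iff[of x y] by force
  have "(f x - f a) * (1 / a) \<le> (f x - f y) * (2 * x / (x\<^sup>2 - y\<^sup>2))"
  proof (rule mult_mono)
    have "x\<^sup>2 - y\<^sup>2 \<le> x\<^sup>2" by simp
    also have "\<dots> \<le> 2 * x * a" using assms by (simp add: power2_eq_square)
    finally show "1 / a \<le> 2 * x / (x\<^sup>2 - y\<^sup>2)" using assms lt by (simp add: field_simps)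
  qed (use fa assms in auto)
  also have "\<dots> = hilbert_kernel f x y"
    using lt by (simp add: hilbert_kernel_def divide_simps) (simp add: algebra_simps)
  finally show ?thesis by simp
qed

lemma hilbert_kernel_ge_outer:
  assumes "0 < a" "a \<le> x" "x \<le> 2 * a" "2 * a \<le> y" "y \<le> 4 * a"
  shows "(f (2 * a) - f x) / (8 * a) \<le> hilbert_kernel f x y"
proof (cases "y = x")
  case True
  then have "x = 2 * a" using assms by simp
  then show ?thesis using hilbert_kernel_nonneg[of x y] assms by simp
next
  case False
  have fa: "f x \<le> f (2 * a)" "f (2 * a) \<le> f y" using assms by (auto intro!: mono_abs)
  have lt: "x\<^sup>2 < y\<^sup>2" using False assms by (intro power_strict_mono) auto
  have "(f (2 * a) - f x) * (1 / (8 * a)) \<le> (f y - f x) * (2 * x / (y\<^sup>2 - x\<^sup>2))"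
  proof (rule mult_mono)
    have "y\<^sup>2 - x\<^sup>2 \<le> (4 * a)\<^sup>2" using assms power_mono[of y "4 * a" 2] zero_le_power2[of x] by linarith
    also have "\<dots> \<le> 2 * x * (8 * a)" using assms by (simp add: power2_eq_square)
    finally show "1 / (8 * a) \<le> 2 * x / (y\<^sup>2 - x\<^sup>2)" using assms lt by (simp add: field_simps)
  qed (use fa assms in auto)
  also have "\<dots> = hilbert_kernel f x y" by (simp add: hilbert_kernel_def)
  finally show ?thesis by simp
qed

lemma hilbert_dyadic_bound:
  assumes a: "0 < a" "a \<le> x" "x \<le> 2 * a"
  shows "(f (2 * a) - f a) / (8 * pi) \<le> - hilbert f x"
proof -
  let ?l = "\<lambda>y. (f x - f a) / a * indicator {-a..a} y + (f (2 * a) - f x) / (8 * a) * indicator {2 * a..4 * a} y"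
  have le: "f a \<le> f x" "f x \<le> f (2 * a)" using a by (auto intro!: mono)
  have l: "has_bochner_integral lborel ?l
      ((f x - f a) / a * measure lborel {-a..a} + (f (2 * a) - f x) / (8 * a) * measure lborel {2 * a..4 * a})"
    using a by (intro has_bochner_integral_add has_bochner_integral_mult_right has_bochner_integral_real_indicator)
      (auto simp: emeasure_lborel_Icc_eq)
  have "(LINT y|lborel. ?l y) \<le> (LINT y|lborel. hilbert_kernel f x y)"
  proof (rule integral_mono)
    show "?l y \<le> hilbert_kernel f x y" for y
      using hilbert_kernel_ge_inner[OF a, of y] hilbert_kernel_ge_outer[OF a, of y] hilbert_kernel_nonneg[of x y] a
      by (auto simp: indicator_def)
  qed (use l hilbert_kernel_integrable a in \<open>auto simp: has_bochner_integral_iff\<close>)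
  also have "(LINT y|lborel. ?l y) = 2 * (f x - f a) + (f (2 * a) - f x) / 4"
    using l a by (simp add: has_bochner_integral_iff)
  finally have "(f (2 * a) - f a) / 4 \<le> (LINT y|lborel. hilbert_kernel f x y)" using le by argo
  then show ?thesis using hilbert_eq[of x] a by (simp add: field_simps)
qed

end

abbreviation dyadic :: "nat \<Rightarrow> real set" where
  "dyadic k \<equiv> {(1 / 2) ^ Suc k<..(1 / 2) ^ k}"

lemma disjoint_dyadic: "disjoint_family dyadic"
proof -
  have "dyadic i \<inter> dyadic j = {}" if "i < j" for i j
    using power_decreasing[of "Suc i" j "1 / 2 :: real"] that by auto
  then show ?thesis unfolding disjoint_family_on_def by (metis inf_commute linorder_neqE_nat)
qed

lemma Union_dyadic: "(\<Union>k. dyadic k) = {0<..1}"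
proof (intro equalityI subsetI)
  fix x assume "x \<in> (\<Union>k. dyadic k)"
  then obtain k where k: "x \<in> dyadic k" by auto
  have "(0::real) < (1 / 2) ^ Suc k" "(1 / 2 :: real) ^ k \<le> 1" by (simp_all add: power_le_one)
  moreover have "(1 / 2) ^ Suc k < x" "x \<le> (1 / 2) ^ k" using k by (simp_all only: greaterThanAtMost_iff)
  ultimately have "0 < x" "x \<le> 1" by linarith+
  then show "x \<in> {0<..1}" by simp
next
  fix x :: real assume x: "x \<in> {0<..1}"
  define k where "k = (LEAST n. (1 / 2) ^ Suc n < x)"
  obtain n where "(1 / 2) ^ n < x" using x real_arch_pow_inv[of x "1 / 2"] by auto
  moreover have "(1 / 2 :: real) ^ Suc n \<le> (1 / 2) ^ n" by (intro power_decreasing) auto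
  ultimately have "(1 / 2) ^ Suc n < x" by linarith
  then have k: "(1 / 2) ^ Suc k < x" unfolding k_def by (rule LeastI)
  have "x \<le> (1 / 2) ^ k"
  proof (cases k)
    case (Suc m)
    then have "\<not> (1 / 2) ^ Suc m < x" using not_less_Least[of m "\<lambda>n. (1 / 2) ^ Suc n < x"] by (simp add: k_def)
    then show ?thesis using Suc by simp
  qed (use x in simp)
  with k show "x \<in> (\<Union>k. dyadic k)" by auto
qed

lemma nn_integral_dyadic:
  fixes h :: "real \<Rightarrow> ennreal"
  assumes meas: "(\<lambda>x. h x * indicator {0..1} x) \<in> borel_measurable lborel" and "h 0 = 0"
  shows "(\<integral>\<^sup>+x\<in>{0..1}. h x \<partial>lborel) = (\<Sum>k. \<integral>\<^sup>+x\<in>dyadic k. h x \<partial>lborel)"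
proof -
  define g where "g x = h x * indicator {0..1} x" for x
  have [measurable]: "g \<in> borel_measurable lborel" using meas by (simp add: g_def[abs_def])
  have "dyadic k \<subseteq> {0..1}" for k using Union_dyadic by fastforce
  then have g: "g x * indicator (dyadic k) x = h x * indicator (dyadic k) x" for x k
    using subsetD[of "dyadic k" "{0..1}" x] unfolding g_def indicator_def
    by (simp del: greaterThanAtMost_iff atLeastAtMost_iff power_Suc)
  have "(\<integral>\<^sup>+x\<in>{0..1}. h x \<partial>lborel) = (\<integral>\<^sup>+x\<in>(\<Union>k. dyadic k). g x \<partial>lborel)"
    unfolding Union_dyadic using \<open>h 0 = 0\<close>
    by (intro nn_integral_cong) (auto simp: g_def indicator_def less_le)
  also have "\<dots> = emeasure (density lborel g) (\<Union>k. dyadic k)"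
    unfolding Union_dyadic by (simp add: emeasure_density)
  also have "\<dots> = (\<Sum>k. emeasure (density lborel g) (dyadic k))"
    using disjoint_dyadic by (intro suminf_emeasure[symmetric]) auto
  also have "\<dots> = (\<Sum>k. \<integral>\<^sup>+x\<in>dyadic k. h x \<partial>lborel)"
    by (simp add: emeasure_density g del: power_Suc)
  finally show ?thesis .
qed

context even_profile
begin

lemma measurable_hilbert:
  "(\<lambda>x. indicator {0<..} x * hilbert f x) \<in> borel_measurable borel"
proof -
  have "(\<lambda>x. - (1 / (2 * pi)) * (LINT y|lborel. hilbert_kernel f x y)) \<in> borel_measurable borel"
    unfolding hilbert_kernel_def by measurable
  then have "(\<lambda>x. indicator {0<..} x * (- (1 / (2 * pi)) * (LINT y|lborel. hilbert_kernel f x y))) \<in> borel_measurable borel"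
    by measurable
  also have "(\<lambda>x. indicator {0<..} x * (- (1 / (2 * pi)) * (LINT y|lborel. hilbert_kernel f x y)))
      = (\<lambda>x. indicator {0<..} x * hilbert f x)"
    by (auto simp: fun_eq_iff hilbert_eq indicator_def)
  finally show ?thesis .
qed

lemma measurable_dissipation:
  "(\<lambda>x. indicator {0..1} x * (hilbert f x * deriv f x * rpow (f x) (p - 1) / x powr \<sigma>)) \<in> borel_measurable borel"
proof -
  note measurable_hilbert [measurable]
  have "(\<lambda>x. indicator {0..1} x * ((indicator {0<..} x * hilbert f x) * deriv f x * rpow (f x) (p - 1) / x powr \<sigma>))
      \<in> borel_measurable borel"
    unfolding rpow_def by measurable
  also have "(\<lambda>x. indicator {0..1} x * ((indicator {0<..} x * hilbert f x) * deriv f x * rpow (f x) (p - 1) / x powr \<sigma>))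
      = (\<lambda>x. indicator {0..1} x * (hilbert f x * deriv f x * rpow (f x) (p - 1) / x powr \<sigma>))"
    by (auto simp: fun_eq_iff indicator_def)
  finally show ?thesis .
qed

lemma dissipation_nonpos:
  "x \<ge> 0 \<Longrightarrow> hilbert f x * deriv f x * rpow (f x) (p - 1) / x powr \<sigma> \<le> 0"
  by (cases "x = 0")
    (auto simp: rpow_def intro!: divide_nonpos_nonneg mult_nonpos_nonneg hilbert_nonpos deriv_nonneg)

lemma dissipation_dyadic:
  assumes a: "a > 0" and p: "p \<ge> 1" and \<sigma>: "\<sigma> > 0"
  shows "ennreal (1 / (8 * pi * 2 powr p) * ((2 * a) powr (- \<sigma>) * (f (2 * a) - f a) powr (p + 1)))
    \<le> (\<integral>\<^sup>+x\<in>{a<..2 * a}. ennreal (- (hilbert f x * deriv f x * rpow (f x) (p - 1) / x powr \<sigma>)) \<partial>lborel)"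
proof (cases "f a = f (2 * a)")
  case True
  then show ?thesis by simp
next
  case False
  define d where "d = f (2 * a) - f a"
  have d: "d > 0" using False mono[of a "2 * a"] a by (simp add: d_def)
  \<comment> \<open>Restricting to where \<open>f\<close> lies above the midpoint of its range on \<open>[a, 2 * a]\<close> bounds
    \<open>f powr (p - 1)\<close> below while \<open>f\<close> still increases by \<open>d / 2\<close> there.\<close>
  obtain c where c: "a \<le> c" "c \<le> 2 * a" "f c = f a + d / 2"
    using IVT'[of f a "f a + d / 2" "2 * a"] a d continuous_on_subset[OF continuous_f]
    by (auto simp: d_def field_simps)
  have "c \<noteq> a" using c d by auto
  define K where "K = d / (8 * pi) * (d / 2) powr (p - 1) * (2 * a) powr (- \<sigma>)"
  have K: "K \<ge> 0" using d by (simp add: K_def)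
  have bound: "K * deriv f x \<le> - (hilbert f x * deriv f x * rpow (f x) (p - 1) / x powr \<sigma>)"
    if x: "x \<in> {c..2 * a}" for x
  proof -
    have "x > 0" using x c a by simp
    have H: "d / (8 * pi) \<le> - hilbert f x"
      using hilbert_dyadic_bound[of a x] a x c by (simp add: d_def)
    have "d / 2 \<le> f x" using mono[of c x] x c a nonneg[of a] by auto
    then have P: "(d / 2) powr (p - 1) \<le> rpow (f x) (p - 1)"
      using p d by (auto simp: rpow_def intro!: powr_mono2)
    have S: "(2 * a) powr (- \<sigma>) \<le> x powr (- \<sigma>)"
      using x \<open>x > 0\<close> \<sigma> by (intro powr_mono2') auto
    have "K * deriv f x \<le> (- hilbert f x * rpow (f x) (p - 1) * x powr (- \<sigma>)) * deriv f x"
      unfolding K_def using H P S d deriv_nonneg[OF \<open>x > 0\<close>] hilbert_nonpos[OF \<open>x > 0\<close>]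
      by (intro mult_right_mono mult_mono mult_nonneg_nonneg) (auto simp: rpow_def intro: order_trans[rotated])
    then show ?thesis by (simp add: powr_minus_divide mult_ac)
  qed
  have "1 / (8 * pi * 2 powr p) * ((2 * a) powr (- \<sigma>) * d powr (p + 1)) = K * (d / 2)"
  proof -
    have "(d / 2) powr (p - 1) * (d / 2) = (d / 2) powr p"
      using d powr_add[of "d / 2" "p - 1" 1] by simp
    also have "\<dots> = d powr p / 2 powr p" using d by (simp add: powr_divide)
    finally have "K * (d / 2) = d / (8 * pi) * (d powr p / 2 powr p) * (2 * a) powr (- \<sigma>)"
      unfolding K_def by (simp add: mult_ac)
    then show ?thesis using d by (simp add: powr_add field_simps)
  qed
  also have "ennreal \<dots> = ennreal K * ennreal (f (2 * a) - f c)"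
  proof -
    have eq: "f (2 * a) - f c = d / 2" using c(3) unfolding d_def by argo
    show ?thesis unfolding eq using K d by (intro ennreal_mult) auto
  qed
  also have "ennreal (f (2 * a) - f c) = (\<integral>\<^sup>+x. ennreal (deriv f x) * indicator {c..2 * a} x \<partial>lborel)"
    using c a by (intro nn_integral_FTC_Icc[symmetric]) (auto intro!: has_field_derivative_at_within has_deriv deriv_nonneg)
  also have "ennreal K * \<dots> = (\<integral>\<^sup>+x. ennreal K * (ennreal (deriv f x) * indicator {c..2 * a} x) \<partial>lborel)"
    by (intro nn_integral_cmult[symmetric]) measurable
  also have "\<dots> \<le> (\<integral>\<^sup>+x\<in>{a<..2 * a}. ennreal (- (hilbert f x * deriv f x * rpow (f x) (p - 1) / x powr \<sigma>)) \<partial>lborel)"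
  proof (rule nn_integral_mono)
    fix x
    show "ennreal K * (ennreal (deriv f x) * indicator {c..2 * a} x)
      \<le> ennreal (- (hilbert f x * deriv f x * rpow (f x) (p - 1) / x powr \<sigma>)) * indicator {a<..2 * a} x"
    proof (cases "x \<in> {c..2 * a}")
      case True
      then have "x > a" using c \<open>c \<noteq> a\<close> by auto
      with True bound[OF True] K a show ?thesis
        by (simp add: ennreal_mult[symmetric] deriv_nonneg ennreal_leI)
    qed simp
  qed
  finally show ?thesis by (simp add: d_def)
qed

lemma weighted_power_dyadic:
  assumes a: "a > 0" and p: "p \<ge> 1" and \<sigma>: "\<sigma> > 0"
  shows "(\<integral>\<^sup>+x\<in>{a<..2 * a}. ennreal (rpow (f x) (p + 1) / x powr (1 + \<sigma>)) \<partial>lborel)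
    \<le> ennreal (a powr (- \<sigma>) * f (2 * a) powr (p + 1))"
proof -
  have "(\<integral>\<^sup>+x\<in>{a<..2 * a}. ennreal (rpow (f x) (p + 1) / x powr (1 + \<sigma>)) \<partial>lborel)
      \<le> (\<integral>\<^sup>+x. ennreal (f (2 * a) powr (p + 1) / a powr (1 + \<sigma>)) * indicator {a<..2 * a} x \<partial>lborel)"
  proof (rule nn_integral_mono)
    fix x
    have "rpow (f x) (p + 1) / x powr (1 + \<sigma>) \<le> f (2 * a) powr (p + 1) / a powr (1 + \<sigma>)"
      if "x \<in> {a<..2 * a}"
      using that a p \<sigma> nonneg unfolding rpow_def
      by (auto intro!: frac_le powr_mono2 mono)
    then show "ennreal (rpow (f x) (p + 1) / x powr (1 + \<sigma>)) * indicator {a<..2 * a} x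
      \<le> ennreal (f (2 * a) powr (p + 1) / a powr (1 + \<sigma>)) * indicator {a<..2 * a} x"
      by (auto simp: indicator_def intro!: ennreal_leI)
  qed
  also have "\<dots> = ennreal (f (2 * a) powr (p + 1) / a powr (1 + \<sigma>)) * ennreal a"
    using a by (subst nn_integral_cmult_indicator) auto
  also have "\<dots> = ennreal (a powr (- \<sigma>) * f (2 * a) powr (p + 1))"
    using a by (subst ennreal_mult[symmetric]) (auto simp: powr_add powr_minus_divide)
  finally show ?thesis .
qed

lemma dissipation_ge:
  assumes p: "p \<ge> 1" and \<sigma>: "\<sigma> > 0" and "C > 0"
    and hardy: "\<And>a :: nat \<Rightarrow> real. decseq a \<Longrightarrow> a \<longlonglongrightarrow> 0 \<Longrightarrow>
      (\<Sum>k. ennreal ((2 powr \<sigma>) ^ k * a k powr (p + 1)))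
        \<le> ennreal C * (\<Sum>k. ennreal ((2 powr \<sigma>) ^ k * (a k - a (Suc k)) powr (p + 1)))"
  shows "ennreal (1 / (8 * pi * 2 powr p) / (2 powr \<sigma> * C))
      * (\<integral>\<^sup>+x\<in>{0..1}. ennreal (rpow (f x) (p + 1) / x powr (1 + \<sigma>)) \<partial>lborel)
    \<le> (\<integral>\<^sup>+x\<in>{0..1}. ennreal (- (hilbert f x * deriv f x * rpow (f x) (p - 1) / x powr \<sigma>)) \<partial>lborel)"
    (is "ennreal (?c / _) * ?R \<le> ?L")
proof -
  define w where "w = 2 powr \<sigma>"
  define a where "a k = f ((1 / 2) ^ k)" for k
  let ?D = "\<Sum>k. ennreal (w ^ k * (a k - a (Suc k)) powr (p + 1))"
  have w: "w > 0" by (simp add: w_def)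
  have c: "?c > 0" by simp
  have "(1 / 2) powr (- \<sigma>) = w" by (simp add: w_def powr_divide powr_minus)
  then have half: "((1 / 2) ^ k) powr (- \<sigma>) = w ^ k" for k
  proof -
    have "((1 / 2 :: real) ^ k) powr (- \<sigma>) = ((1 / 2) powr real k) powr (- \<sigma>)"
      by (subst powr_realpow) auto
    also have "\<dots> = (1 / 2) powr (real k * - \<sigma>)" by (rule powr_powr)
    also have "\<dots> = ((1 / 2) powr (- \<sigma>)) ^ k" by (subst powr_power) auto
    also have "\<dots> = w ^ k" using \<open>(1 / 2) powr (- \<sigma>) = w\<close> by (simp only:)
    finally show ?thesis .
  qed
  have dec: "decseq a"
    unfolding decseq_Suc_iff a_def by (auto intro!: mono)
  have lim: "a \<longlonglongrightarrow> 0"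
  proof -
    have "(\<lambda>k. f ((1 / 2) ^ k)) \<longlonglongrightarrow> f 0"
      by (rule isCont_tendsto_compose[of 0 f])
        (auto intro: DERIV_isCont has_deriv LIMSEQ_realpow_zero)
    then show ?thesis by (simp add: a_def[abs_def] zero)
  qed
  have "?R = (\<Sum>k. \<integral>\<^sup>+x\<in>dyadic k. ennreal (rpow (f x) (p + 1) / x powr (1 + \<sigma>)) \<partial>lborel)"
    unfolding rpow_def by (rule nn_integral_dyadic) auto
  also have "\<dots> \<le> (\<Sum>k. ennreal w * ennreal (w ^ k * a k powr (p + 1)))"
  proof (intro suminf_le)
    fix k
    show "(\<integral>\<^sup>+x\<in>dyadic k. ennreal (rpow (f x) (p + 1) / x powr (1 + \<sigma>)) \<partial>lborel)
        \<le> ennreal w * ennreal (w ^ k * a k powr (p + 1))"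
      using weighted_power_dyadic[of "(1 / 2) ^ Suc k" p \<sigma>] p \<sigma> w half[of "Suc k"]
      by (simp add: a_def ennreal_mult[symmetric] mult_ac)
  qed auto
  also have "\<dots> = ennreal w * (\<Sum>k. ennreal (w ^ k * a k powr (p + 1)))" by simp
  also have "\<dots> \<le> ennreal w * (ennreal C * ?D)"
    using hardy[OF dec lim] unfolding w_def by (rule mult_left_mono) simp
  also have "\<dots> = ennreal (w * C) * ?D"
    using w \<open>C > 0\<close> by (simp add: ennreal_mult mult.assoc)
  finally have "ennreal (?c / (w * C)) * ?R \<le> ennreal (?c / (w * C)) * (ennreal (w * C) * ?D)"
    by (intro mult_left_mono) auto
  also have "\<dots> = ennreal ?c * ?D"
  proof -
    have "ennreal (?c / (w * C)) * ennreal (w * C) = ennreal (?c / (w * C) * (w * C))"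
      using w \<open>C > 0\<close> c by (intro ennreal_mult[symmetric]) auto
    also have "?c / (w * C) * (w * C) = ?c" using w \<open>C > 0\<close> by simp
    finally show ?thesis by (simp only: mult.assoc[symmetric])
  qed
  also have "\<dots> = (\<Sum>k. ennreal ?c * ennreal (w ^ k * (a k - a (Suc k)) powr (p + 1)))" by simp
  also have "\<dots> \<le> (\<Sum>k. \<integral>\<^sup>+x\<in>dyadic k. ennreal (- (hilbert f x * deriv f x * rpow (f x) (p - 1) / x powr \<sigma>)) \<partial>lborel)"
  proof (intro suminf_le)
    fix k
    show "ennreal ?c * ennreal (w ^ k * (a k - a (Suc k)) powr (p + 1))
      \<le> (\<integral>\<^sup>+x\<in>dyadic k. ennreal (- (hilbert f x * deriv f x * rpow (f x) (p - 1) / x powr \<sigma>)) \<partial>lborel)"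
      using dissipation_dyadic[of "(1 / 2) ^ Suc k" p \<sigma>] p \<sigma> w half[of k]
      by (simp add: a_def ennreal_mult[symmetric])
  qed auto
  also have "\<dots> = ?L"
  proof (rule nn_integral_dyadic[symmetric])
    have "(\<lambda>x. ennreal (- (indicator {0..1} x * (hilbert f x * deriv f x * rpow (f x) (p - 1) / x powr \<sigma>))))
        \<in> borel_measurable lborel"
      using measurable_dissipation[of p \<sigma>] by measurable
    also have "(\<lambda>x. ennreal (- (indicator {0..1} x * (hilbert f x * deriv f x * rpow (f x) (p - 1) / x powr \<sigma>))))
        = (\<lambda>x. ennreal (- (hilbert f x * deriv f x * rpow (f x) (p - 1) / x powr \<sigma>)) * indicator {0..1} x)"
      by (auto simp: fun_eq_iff indicator_def)
    finally show "\<dots> \<in> borel_measurable lborel" .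
  qed auto
  finally show ?thesis by (simp add: w_def)
qed

end

theorem proposition6p4:
  fixes p \<sigma> :: real
  assumes "p \<ge> 1" and "\<sigma> > 0"
  shows "\<exists>C0>0. \<forall>f :: real \<Rightarrow> real.
    f C1_differentiable_on UNIV \<and> (\<forall>x. f (- x) = f x) \<and> bounded (range f) \<and>
    f 0 = 0 \<and> (\<forall>x>0. deriv f x \<ge> 0) \<longrightarrow>
      quasi_integrable {0..1} (\<lambda>x. hilbert f x * deriv f x * rpow (f x) (p - 1) / x powr \<sigma>) \<and>
      quasi_integrable {0..1} (\<lambda>x. rpow (f x) (p + 1) / x powr (1 + \<sigma>)) \<and>
      - ext_integral {0..1} (\<lambda>x. hilbert f x * deriv f x * rpow (f x) (p - 1) / x powr \<sigma>)
        \<ge> ereal C0 * ext_integral {0..1} (\<lambda>x. rpow (f x) (p + 1) / x powr (1 + \<sigma>))"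
proof -
  have "(2::real) powr 0 < 2 powr \<sigma>" using assms by (intro powr_less_mono) auto
  then obtain C where C: "C > 0"
    and hardy: "\<And>a :: nat \<Rightarrow> real. decseq a \<Longrightarrow> a \<longlonglongrightarrow> 0 \<Longrightarrow>
      (\<Sum>k. ennreal ((2 powr \<sigma>) ^ k * a k powr (p + 1)))
        \<le> ennreal C * (\<Sum>k. ennreal ((2 powr \<sigma>) ^ k * (a k - a (Suc k)) powr (p + 1)))"
    using weighted_hardy[of "2 powr \<sigma>" "p + 1"] assms powr_zero_eq_one[of "2::real"] by (smt (verit))
  define C0 where "C0 = 1 / (8 * pi * 2 powr p) / (2 powr \<sigma> * C)"
  have C0: "C0 > 0" using C by (simp add: C0_def)
  show ?thesis
  proof (intro exI[of _ C0] conjI allI impI C0)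
    fix f :: "real \<Rightarrow> real"
    assume "f C1_differentiable_on UNIV \<and> (\<forall>x. f (- x) = f x) \<and> bounded (range f) \<and>
      f 0 = 0 \<and> (\<forall>x>0. deriv f x \<ge> 0)"
    then interpret even_profile f by unfold_locales auto
    let ?g = "\<lambda>x. hilbert f x * deriv f x * rpow (f x) (p - 1) / x powr \<sigma>"
    let ?h = "\<lambda>x. rpow (f x) (p + 1) / x powr (1 + \<sigma>)"
    have "ennreal (?g x) * indicator {0..1} x = 0" for x
      using dissipation_nonpos[of x p \<sigma>] by (auto simp: indicator_def ennreal_neg)
    then have g: "(\<integral>\<^sup>+x\<in>{0..1}. ennreal (?g x) \<partial>lborel) = 0"
      by (intro nn_integral_zero' AE_I2)
    have "?h x \<ge> 0" for x by (simp add: rpow_def)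
    then have "ennreal (- ?h x) = 0" for x by (simp add: ennreal_neg)
    then have h: "(\<integral>\<^sup>+x\<in>{0..1}. ennreal (- ?h x) \<partial>lborel) = 0" by simp
    show "quasi_integrable {0..1} ?g"
      using measurable_dissipation[of p \<sigma>] g by (simp add: quasi_integrable_def set_borel_measurable_def)
    have "(\<lambda>x. indicator {0..1} x *\<^sub>R ?h x) \<in> borel_measurable lborel"
      unfolding rpow_def by measurable
    then show "quasi_integrable {0..1} ?h"
      using h unfolding quasi_integrable_def set_borel_measurable_def by simp
    have "ereal C0 * enn2ereal (\<integral>\<^sup>+x\<in>{0..1}. ennreal (?h x) \<partial>lborel)
        = enn2ereal (ennreal C0 * (\<integral>\<^sup>+x\<in>{0..1}. ennreal (?h x) \<partial>lborel))"
      using C0 by (simp add: times_ennreal.rep_eq enn2ereal_ennreal)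
    also have "\<dots> \<le> enn2ereal (\<integral>\<^sup>+x\<in>{0..1}. ennreal (- ?g x) \<partial>lborel)"
      using dissipation_ge[OF assms C hardy] by (simp add: C0_def less_eq_ennreal.rep_eq[symmetric])
    finally show "ereal C0 * ext_integral {0..1} ?h \<le> - ext_integral {0..1} ?g"
      unfolding ext_integral_def g h by (simp add: zero_ennreal.rep_eq)
  qed
qed

end
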